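(* Let $\mathbf B$ be an $n\times q$ random matrix with i.i.d. $\mathcal N(0,1)$ entries, $\mathbf C$ a deterministic $q\times p$ matrix, and $\mathbf A=\mathbf B\mathbf C$. Let $\mathcal K\subset\mathbb R^p$ be a compact, origin-symmetric convex set with non-empty interior, and let $\varepsilon\ge0$. For $\mathbf x^\star\in\mathcal K$, suppose we observe $\mathbf y=\mathbf A\mathbf x^\star+\boldsymbol\nu$ with $\frac1n\|\boldsymbol\nu\|_1\le\varepsilon$, and choose $\widehat{\mathbf x}$ to be a solution of $$\min\|\mathbf x\|_{\mathcal K}\ \text{ subject to }\ \tfrac1n\|\mathbf A\mathbf x-\mathbf y\|_1\le\varepsilon.$$ Then $$\mathbb E\sup_{\mathbf x^\star\in\mathcal K}\left\{(\widehat{\mathbf x}-\mathbf x^\star)^T\mathbf C^T\mathbf C(\widehat{\mathbf x}-\mathbf x^\star)\right\}^{1/2}\le\sqrt{2\pi}\left(\frac{\mathbb E\sup_{\mathbf u\in\mathcal K-\mathcal K}|\langle\mathbf C^T\mathbf g,\mathbf u\rangle|}{\sqrt n}+\varepsilon\right),$$ where $\mathbf g\sim\mathcal N(0,\mathbf I_q)$ and $\mathcal K-\mathcal K=\{\mathbf u-\mathbf v:\mathbf u,\mathbf v\in\mathcal K\}$.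
   Context: The Minkowski functional of $\mathcal K$ is $\|\mathbf x\|_{\mathcal K}=\inf\{\lambda>0:\lambda^{-1}\mathbf x\in\mathcal K\}$; under the stated assumptions on $\mathcal K$ it is a norm and $\mathbf x\in\mathcal K$ iff $\|\mathbf x\|_{\mathcal K}\le1$. No assumption is made on $\boldsymbol\nu$ other than $\frac1n\|\boldsymbol\nu\|_1\le\varepsilon$. *)

theory Defs
  imports "HOL-Analysis.Analysis" "HOL-Probability.Probability"
begin

definition minkowski_functional :: "'a::real_vector set \<Rightarrow> 'a \<Rightarrow> real" where
  "minkowski_functional K x = Inf {t. 0 < t \<and> scaleR (inverse t) x \<in> K}"

definition norm1 :: "real ^ 'n \<Rightarrow> real" where
  "norm1 v = (\<Sum>i\<in>UNIV. \<bar>v $ i\<bar>)"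

text \<open>Standard Gaussian measure on a Euclidean space: i.i.d. N(0,1) coordinates
  w.r.t. the standard basis (for real^'q^'n: i.i.d. N(0,1) matrix entries).\<close>
definition std_gaussian :: "'a::euclidean_space measure" where
  "std_gaussian = density lborel (\<lambda>x. ennreal (\<Prod>b\<in>Basis. std_normal_density (x \<bullet> b)))"

text \<open>Outer expectation (upper integral) of a possibly non-measurable nonnegative function;
  it coincides with the nonnegative integral when f is measurable.\<close>
definition outer_nn_integral :: "'a measure \<Rightarrow> ('a \<Rightarrow> ennreal) \<Rightarrow> ennreal" where
  "outer_nn_integral M f =
     (INF h\<in>{h. h \<in> borel_measurable M \<and> (\<forall>x\<in>space M. f x \<le> h x)}. nn_integral M h)"

definition l1_recovery_solutions ::
  "(real ^ 'p) set \<Rightarrow> real \<Rightarrow> real ^ 'p ^ 'n \<Rightarrow> real ^ 'n \<Rightarrow> (real ^ 'p) set" where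
  "l1_recovery_solutions K eps A y =
     {x. norm1 (A *v x - y) / real CARD('n) \<le> eps \<and>
         (\<forall>z. norm1 (A *v z - y) / real CARD('n) \<le> eps \<longrightarrow>
              minkowski_functional K x \<le> minkowski_functional K z)}"

end

theory Submission
  imports Defs
begin

text \<open>
  Since \<open>x\<^sup>\<star>\<close> is feasible, the solution lies in \<open>K\<close>, and the image \<open>v\<close> under \<open>C\<close> of the error lies in
  \<open>S = C(K - K)\<close> with \<open>\<parallel>Bv\<parallel>\<^sub>1 / n \<le> 2 \<epsilon>\<close>. As \<open>\<parallel>Bv\<parallel>\<^sub>1 / n\<close> has mean \<open>\<surd>(2/\<pi>) \<parallel>v\<parallel>\<close>, it remains to bound the
  expected supremum over \<open>S\<close> of the one-sided deviation \<open>\<surd>(2/\<pi>) \<parallel>v\<parallel> - \<parallel>Bv\<parallel>\<^sub>1 / n\<close>. An independent copy of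
  \<open>B\<close> and random row swaps symmetrize it at the cost of a factor 2, the contraction principle removes the
  absolute values, and the signed sum of the rows of \<open>B\<close> is \<open>\<surd>n g\<close> in law. Only one-sided suprema
  occur, so the contraction costs no further factor 2.

  Suprema are taken in \<^typ>\<open>ennreal\<close>, so negative values are clipped to 0 and no boundedness has to be
  tracked.
\<close>

subsection \<open>Standard Gaussian measures\<close>

abbreviation std_normal :: "real measure" where
  "std_normal \<equiv> density lborel std_normal_density"

lemma sets_std_gaussian [simp, measurable_cong]: "sets std_gaussian = sets borel"
  by (simp add: std_gaussian_def)

lemma space_std_gaussian [simp]: "space std_gaussian = UNIV"
  by (simp add: std_gaussian_def)

lemma prob_space_std_normal: "prob_space std_normal"
  by (rule prob_space_normal_density) simp

text \<open>Both the density and the indicator of a rectangle are products over the coordinates, so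
  the Lebesgue integral factors.\<close>

lemma emeasure_std_gaussian_rectangle:
  assumes [measurable]: "\<And>b. b \<in> Basis \<Longrightarrow> A b \<in> sets borel"
  shows "emeasure (std_gaussian :: 'a::euclidean_space measure) {x. \<forall>b\<in>Basis. x \<bullet> b \<in> A b}
    = (\<Prod>b\<in>Basis. emeasure std_normal (A b))"
proof -
  have "{x::'a. \<forall>b\<in>Basis. x \<bullet> b \<in> A b} = {x\<in>space borel. \<forall>b\<in>Basis. x \<bullet> b \<in> A b}"
    by simp
  also have "\<dots> \<in> sets borel" by measurable
  finally have [measurable]: "{x::'a. \<forall>b\<in>Basis. x \<bullet> b \<in> A b} \<in> sets borel" .
  have "emeasure (std_gaussian :: 'a measure) {x. \<forall>b\<in>Basis. x \<bullet> b \<in> A b} =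
     (\<integral>\<^sup>+x. (\<Prod>b\<in>Basis. ennreal (std_normal_density (x \<bullet> b)) * indicator (A b) (x \<bullet> b)) \<partial>(lborel::'a measure))"
    unfolding std_gaussian_def
    by (subst emeasure_density)
       (auto intro!: nn_integral_cong simp: prod.distrib prod_ennreal[symmetric] indicator_def split: if_splits)
  also have "\<dots> = (\<Prod>b\<in>(Basis::'a set). \<integral>\<^sup>+x. ennreal (std_normal_density x) * indicator (A b) x \<partial>lborel)"
    by (rule nn_integral_lborel_prod) auto
  also have "\<dots> = (\<Prod>b\<in>(Basis::'a set). emeasure std_normal (A b))"
    by (intro prod.cong refl) (simp add: emeasure_density)
  finally show ?thesis .
qed

text \<open>Rectangles determine a finite product measure, so the previous computation identifies
  the coordinates as i.i.d. standard normal.\<close>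

lemma distr_std_gaussian_coordinates:
  "distr (std_gaussian :: 'a::euclidean_space measure) (Pi\<^sub>M Basis (\<lambda>_. borel)) (\<lambda>x. \<lambda>b\<in>Basis. x \<bullet> b)
    = Pi\<^sub>M Basis (\<lambda>_. std_normal)"
proof -
  interpret product_prob_space "\<lambda>_::'a. std_normal" Basis
    by (intro product_prob_spaceI prob_space_std_normal)
  show ?thesis
  proof (rule PiM_eqI)
    show "sets (distr (std_gaussian :: 'a measure) (Pi\<^sub>M Basis (\<lambda>_. borel)) (\<lambda>x. \<lambda>b\<in>Basis. x \<bullet> b))
      = sets (Pi\<^sub>M Basis (\<lambda>_. std_normal))"
      unfolding sets_distr by (rule sets_PiM_cong) simp_all
    fix A :: "'a \<Rightarrow> real set"
    assume "\<And>b. b \<in> Basis \<Longrightarrow> A b \<in> sets std_normal"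
    then have A [measurable]: "\<And>b. b \<in> Basis \<Longrightarrow> A b \<in> sets borel" by simp
    have "emeasure (distr (std_gaussian :: 'a measure) (Pi\<^sub>M Basis (\<lambda>_. borel)) (\<lambda>x. \<lambda>b\<in>Basis. x \<bullet> b)) (Pi\<^sub>E Basis A)
      = emeasure (std_gaussian :: 'a measure) ((\<lambda>x. \<lambda>b\<in>Basis. x \<bullet> b) -` Pi\<^sub>E Basis A \<inter> space std_gaussian)"
      by (rule emeasure_distr) (auto intro!: sets_PiM_I_finite A)
    also have "(\<lambda>x::'a. \<lambda>b\<in>Basis. x \<bullet> b) -` Pi\<^sub>E Basis A \<inter> space std_gaussian = {x. \<forall>b\<in>Basis. x \<bullet> b \<in> A b}"
      by (auto simp: PiE_iff)
    also have "emeasure std_gaussian {x::'a. \<forall>b\<in>Basis. x \<bullet> b \<in> A b} = (\<Prod>b\<in>Basis. emeasure std_normal (A b))"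
      by (rule emeasure_std_gaussian_rectangle[OF A])
    finally show "emeasure (distr (std_gaussian :: 'a measure) (Pi\<^sub>M Basis (\<lambda>_. borel)) (\<lambda>x. \<lambda>b\<in>Basis. x \<bullet> b)) (Pi\<^sub>E Basis A)
      = (\<Prod>b\<in>Basis. emeasure std_normal (A b))" .
  qed simp
qed

lemma prob_space_std_gaussian: "prob_space (std_gaussian :: 'a::euclidean_space measure)"
proof
  have "emeasure std_normal UNIV = 1"
    using prob_space.emeasure_space_1[OF prob_space_std_normal] by simp
  then show "emeasure (std_gaussian :: 'a measure) (space std_gaussian) = 1"
    using emeasure_std_gaussian_rectangle[of "\<lambda>_::'a. UNIV"] by simp
qed

interpretation std_gaussian: prob_space "std_gaussian :: 'a::euclidean_space measure"
  by (rule prob_space_std_gaussian)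

lemma distributed_std_gaussian_inner_Basis:
  assumes "b \<in> Basis"
  shows "distributed (std_gaussian :: 'a::euclidean_space measure) lborel (\<lambda>x. x \<bullet> b) std_normal_density"
proof -
  interpret product_prob_space "\<lambda>_::'a. std_normal" Basis
    by (intro product_prob_spaceI prob_space_std_normal)
  have "distr (std_gaussian :: 'a measure) lborel (\<lambda>x. x \<bullet> b)
     = distr (std_gaussian :: 'a measure) borel (\<lambda>x. x \<bullet> b)"
    by (rule distr_cong) auto
  also have "\<dots> = distr (distr (std_gaussian :: 'a measure) (Pi\<^sub>M Basis (\<lambda>_. borel)) (\<lambda>x. \<lambda>b\<in>Basis. x \<bullet> b))
           borel (\<lambda>f. f b)"
    using assms by (subst distr_distr) (auto simp: comp_def)
  also have "\<dots> = distr (Pi\<^sub>M Basis (\<lambda>_. std_normal)) std_normal (\<lambda>f. f b)"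
    unfolding distr_std_gaussian_coordinates by (rule distr_cong) auto
  also have "\<dots> = std_normal"
    using assms by (rule PiM_component)
  finally show ?thesis
    unfolding distributed_def by auto
qed

lemma indep_vars_std_gaussian_inner_Basis:
  "std_gaussian.indep_vars (\<lambda>_. borel) (\<lambda>b (x::'a::euclidean_space). x \<bullet> b) Basis"
proof -
  have "distr (std_gaussian :: 'a measure) borel (\<lambda>x. x \<bullet> b) = std_normal" if "b \<in> Basis" for b
    using distributed_std_gaussian_inner_Basis[OF that]
    by (auto simp: distributed_def cong: distr_cong)
  then show ?thesis
    by (subst std_gaussian.indep_vars_iff_distr_eq_PiM')
       (auto simp: distr_std_gaussian_coordinates intro!: PiM_cong)
qed

text \<open>The joint law of the \<open>Y b\<close> is that of the coordinate map under
  \<open>std_gaussian\<close>, and summing against the basis inverts that map. Transformed vectors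
  are recognized as Gaussian in this way.\<close>

lemma (in prob_space) distr_indep_std_normal_eq_std_gaussian:
  fixes Y :: "'b::euclidean_space \<Rightarrow> 'a \<Rightarrow> real"
  assumes indep: "indep_vars (\<lambda>_. borel) Y Basis"
    and normal: "\<And>b. b \<in> Basis \<Longrightarrow> distributed M lborel (Y b) std_normal_density"
  shows "distr M borel (\<lambda>\<omega>. \<Sum>b\<in>Basis. Y b \<omega> *\<^sub>R b) = std_gaussian"
proof -
  have [measurable]: "Y b \<in> borel_measurable M" if "b \<in> Basis" for b
    using indep that by (auto simp: indep_vars_def)
  have law: "distr M borel (Y b) = std_normal" if "b \<in> Basis" for b
    using normal[OF that] by (auto simp: distributed_def cong: distr_cong)
  have joint: "distr M (Pi\<^sub>M Basis (\<lambda>_. borel)) (\<lambda>\<omega>. \<lambda>b\<in>Basis. Y b \<omega>) = Pi\<^sub>M Basis (\<lambda>_. std_normal)"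
    using indep by (subst (asm) indep_vars_iff_distr_eq_PiM') (auto simp: law intro!: PiM_cong)
  let ?S = "\<lambda>f::'b \<Rightarrow> real. \<Sum>b\<in>Basis. f b *\<^sub>R b"
  have "distr M borel (\<lambda>\<omega>. \<Sum>b\<in>Basis. Y b \<omega> *\<^sub>R b)
    = distr (distr M (Pi\<^sub>M Basis (\<lambda>_. borel)) (\<lambda>\<omega>. \<lambda>b\<in>Basis. Y b \<omega>)) borel ?S"
    by (subst distr_distr) (auto simp: comp_def)
  also have "\<dots> = distr (distr std_gaussian (Pi\<^sub>M Basis (\<lambda>_. borel)) (\<lambda>x. \<lambda>b\<in>Basis. x \<bullet> b)) borel ?S"
    unfolding joint distr_std_gaussian_coordinates ..
  also have "\<dots> = distr std_gaussian borel (\<lambda>x::'b. x)"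
    by (subst distr_distr) (auto simp: comp_def euclidean_representation)
  also have "\<dots> = std_gaussian"
    by (rule distr_id2) simp
  finally show ?thesis .
qed

section \<open>Linear functionals and linear images of a Gaussian vector\<close>

lemma distributed_std_gaussian_inner:
  fixes a :: "'a::euclidean_space"
  assumes a: "a \<noteq> 0"
  shows "distributed std_gaussian lborel (\<lambda>x. x \<bullet> a) (normal_density 0 (norm a))"
proof -
  \<comment> \<open>Coordinates with zero coefficient are dropped, because
    \<open>sum_indep_normal\<close> requires positive standard deviations.\<close>
  define I where "I = {i\<in>Basis. a \<bullet> i \<noteq> 0}"
  have I: "I \<subseteq> Basis" "finite I" by (auto simp: I_def)
  have "I \<noteq> {}" using a euclidean_all_zero_iff[of a] by (auto simp: I_def)
  have "std_gaussian.indep_vars (\<lambda>_. borel) (\<lambda>i x. (a \<bullet> i) * (x \<bullet> i)) I"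
    by (rule std_gaussian.indep_vars_compose2[OF
          std_gaussian.indep_vars_subset[OF indep_vars_std_gaussian_inner_Basis I(1)]]) simp
  moreover have "distributed std_gaussian lborel (\<lambda>x. (a \<bullet> i) * (x \<bullet> i)) (normal_density 0 \<bar>a \<bullet> i\<bar>)"
    if "i \<in> I" for i
    using std_gaussian.normal_density_affine[OF distributed_std_gaussian_inner_Basis[of i], of "a \<bullet> i" 0] that
    by (auto simp: I_def)
  ultimately have "distributed std_gaussian lborel (\<lambda>x. \<Sum>i\<in>I. (a \<bullet> i) * (x \<bullet> i))
      (normal_density (\<Sum>i\<in>I. 0) (sqrt (\<Sum>i\<in>I. \<bar>a \<bullet> i\<bar>\<^sup>2)))"
    using I \<open>I \<noteq> {}\<close> by (intro std_gaussian.sum_indep_normal) (auto simp: I_def)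
  moreover have "(\<Sum>i\<in>I. (a \<bullet> i) * (x \<bullet> i)) = x \<bullet> a" for x
    unfolding euclidean_inner[of x a] by (rule sum.mono_neutral_cong_left) (auto simp: I_def)
  moreover have "sqrt (\<Sum>i\<in>I. \<bar>a \<bullet> i\<bar>\<^sup>2) = norm a"
    unfolding norm_eq_sqrt_inner euclidean_inner[of a a]
    by (intro arg_cong[where f=sqrt] sum.mono_neutral_cong_left) (auto simp: I_def power2_eq_square)
  ultimately show ?thesis by simp
qed

lemma nn_integral_abs_inner_std_gaussian:
  fixes a :: "'a::euclidean_space"
  shows "(\<integral>\<^sup>+x. ennreal \<bar>x \<bullet> a\<bar> \<partial>std_gaussian) = ennreal (sqrt (2 / pi) * norm a)"
proof (cases "a = 0")
  case False
  then have pos: "0 < norm a" by simp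
  have "(\<integral>\<^sup>+x. ennreal \<bar>x \<bullet> a\<bar> \<partial>std_gaussian) = (\<integral>\<^sup>+t. normal_density 0 (norm a) t * ennreal \<bar>t\<bar> \<partial>lborel)"
    by (rule distributed_nn_integral[OF distributed_std_gaussian_inner[OF False], symmetric]) simp
  \<comment> \<open>The shape of \<open>normal_moment_abs_odd\<close> for the first absolute moment,
    which is the source of the constant \<open>sqrt (2 / pi)\<close>.\<close>
  also have "\<dots> = (\<integral>\<^sup>+t. ennreal (normal_density 0 (norm a) t * \<bar>t - 0\<bar>^(2 * 0 + 1)) \<partial>lborel)"
    by (simp add: ennreal_mult)
  also have "\<dots> = ennreal (sqrt (2 / pi) * norm a)"
    using normal_moment_abs_odd[OF pos, of 0 0]
    by (subst nn_integral_eq_integral) (auto simp: has_bochner_integral_iff ac_simps)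
  finally show ?thesis .
qed simp

text \<open>Disjoint coordinate supports make the images of distinct coordinates independent without
  any rotation invariance; this covers signed coordinate permutations as well as block sums.\<close>

lemma distr_std_gaussian_disjoint_supports:
  fixes a :: "'b::euclidean_space \<Rightarrow> 'a::euclidean_space"
  assumes unit: "\<And>b. b \<in> Basis \<Longrightarrow> norm (a b) = 1"
    and disj: "\<And>b b' i. b \<in> Basis \<Longrightarrow> b' \<in> Basis \<Longrightarrow> i \<in> Basis \<Longrightarrow> b \<noteq> b' \<Longrightarrow> a b \<bullet> i = 0 \<or> a b' \<bullet> i = 0"
  shows "distr std_gaussian borel (\<lambda>x. \<Sum>b\<in>Basis. (x \<bullet> a b) *\<^sub>R b) = std_gaussian"
proof (rule std_gaussian.distr_indep_std_normal_eq_std_gaussian)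
  fix b :: 'b assume b: "b \<in> Basis"
  then have "a b \<noteq> 0" using unit[OF b] by auto
  then show "distributed std_gaussian lborel (\<lambda>x. x \<bullet> a b) (\<lambda>x. ennreal (std_normal_density x))"
    using distributed_std_gaussian_inner[of "a b"] unit[OF b] by simp
next
  define K where "K b = {i\<in>Basis. a b \<bullet> i \<noteq> 0}" for b
  have "std_gaussian.indep_vars (\<lambda>b. Pi\<^sub>M (K b) (\<lambda>_. borel)) (\<lambda>b x. restrict (\<lambda>i. x \<bullet> i) (K b)) Basis"
    using disj by (intro std_gaussian.indep_vars_restrict[OF indep_vars_std_gaussian_inner_Basis])
       (auto simp: K_def disjoint_family_on_def)
  then have "std_gaussian.indep_vars (\<lambda>_. borel)
      (\<lambda>b x. (\<lambda>f. \<Sum>i\<in>K b. f i * (a b \<bullet> i)) (restrict (\<lambda>i. x \<bullet> i) (K b))) Basis"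
    by (rule std_gaussian.indep_vars_compose2) measurable
  moreover have "(\<Sum>i\<in>K b. restrict (\<lambda>i. x \<bullet> i) (K b) i * (a b \<bullet> i)) = x \<bullet> a b" for b x
    unfolding euclidean_inner[of x "a b"] by (rule sum.mono_neutral_cong_left) (auto simp: K_def)
  ultimately show "std_gaussian.indep_vars (\<lambda>_. borel) (\<lambda>b x. x \<bullet> a b) Basis"
    by simp
qed

text \<open>The basis of the product space is the disjoint union of the two embedded bases, so the
  densities multiply. Two independent matrices can thus be treated as one Gaussian vector, on which
  row swaps act.\<close>

lemma std_gaussian_prod:
  "std_gaussian \<Otimes>\<^sub>M std_gaussian = (std_gaussian :: ('a::euclidean_space \<times> 'b::euclidean_space) measure)"
proof -
  have sf: "sigma_finite_measure (density (lborel::'b measure) (\<lambda>x. ennreal (\<Prod>b\<in>Basis. std_normal_density (x \<bullet> b))))"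
    using prob_space_imp_sigma_finite[OF prob_space_std_gaussian] unfolding std_gaussian_def .
  have "(\<Prod>b\<in>Basis. std_normal_density (x \<bullet> b)) * (\<Prod>b\<in>Basis. std_normal_density (y \<bullet> b))
     = (\<Prod>b\<in>Basis. std_normal_density ((x, y) \<bullet> b))" for x :: 'a and y :: 'b
    unfolding Basis_prod_def
    by (subst prod.union_disjoint) (auto simp: prod.reindex inj_on_def)
  then have "(\<lambda>(x :: 'a, y :: 'b). ennreal (\<Prod>b\<in>Basis. std_normal_density (x \<bullet> b))
      * ennreal (\<Prod>b\<in>Basis. std_normal_density (y \<bullet> b)))
    = (\<lambda>p. ennreal (\<Prod>b\<in>Basis. std_normal_density (p \<bullet> b)))"
    by (auto simp: fun_eq_iff ennreal_mult[symmetric] prod_nonneg)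
  then show ?thesis
    unfolding std_gaussian_def
    by (subst pair_measure_density[OF _ _ sigma_finite_lborel sf]) (simp_all add: lborel_prod)
qed

subsection \<open>Contraction\<close>

text \<open>A strict superlevel set of the supremum is a union of open superlevel sets, hence open
  even when \<open>S\<close> is uncountable.\<close>

lemma borel_measurable_SUP_continuous:
  fixes f :: "'i \<Rightarrow> 'a::topological_space \<Rightarrow> real"
  assumes "\<And>v. v \<in> S \<Longrightarrow> continuous_on UNIV (f v)"
  shows "(\<lambda>x. SUP v\<in>S. ennreal (f v x)) \<in> borel_measurable borel"
proof (rule borel_measurableI_greater)
  fix y :: ennreal
  have "{x. y < (SUP v\<in>S. ennreal (f v x))} = (\<Union>v\<in>S. {x. y < ennreal (f v x)})"
    by (auto simp: less_SUP_iff)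
  moreover have "open {x. y < ennreal (f v x)}" if "v \<in> S" for v
    using assms[OF that] by (intro open_Collect_less continuous_on_const continuous_on_ennreal)
  ultimately show "{x \<in> space borel. y < (SUP v\<in>S. ennreal (f v x))} \<in> sets borel"
    by (auto intro!: borel_open)
qed

text \<open>Coercion to \<open>ennreal\<close> takes the positive part, which is
  subadditive.\<close>

lemma ennreal_add_le: "ennreal (a + b) \<le> ennreal a + ennreal b"
proof -
  have "ennreal (a + b) \<le> ennreal (max 0 a + max 0 b)"
    by (rule ennreal_leI) auto
  also have "\<dots> = ennreal a + ennreal b"
    by (simp add: ennreal_plus max_def ennreal_neg)
  finally show ?thesis .
qed

lemma SUP_ennreal_add_le:
  fixes f g :: "'a \<Rightarrow> ennreal"
  assumes "\<And>v w. v \<in> S \<Longrightarrow> w \<in> S \<Longrightarrow> f v + g w \<le> R"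
  shows "(SUP v\<in>S. f v) + (SUP w\<in>S. g w) \<le> R"
\<comment> \<open>A constant can be moved into a supremum only over a nonempty index set; for empty
  \<open>S\<close> both suprema are 0.\<close>
proof (cases "S = {}")
  case False
  have "f v + (SUP w\<in>S. g w) \<le> R" if "v \<in> S" for v
    using assms[OF that] False
    by (subst add.commute, subst ennreal_SUP_add_left[symmetric]) (auto intro!: SUP_least simp: add.commute)
  then show ?thesis
    using False by (subst ennreal_SUP_add_left[symmetric]) (auto intro: SUP_least)
qed simp

text \<open>A sign vector is encoded by the set of its positive coordinates, so a Rademacher average
  becomes a finite sum over all subsets.\<close>

definition set_sign :: "'n set \<Rightarrow> 'n \<Rightarrow> real" where
  "set_sign A i = (if i \<in> A then 1 else - 1)"

text \<open>One coordinate of the contraction principle for \<open>t \<mapsto> \<bar>t\<bar>\<close>: the sign of \<open>t v\<close> decides which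
  supremum on the right absorbs the first summand, and the other one absorbs the second.\<close>

lemma contraction_two_point:
  fixes f t :: "'v \<Rightarrow> real"
  shows "(SUP v\<in>S. ennreal (f v + \<bar>t v\<bar>)) + (SUP v\<in>S. ennreal (f v - \<bar>t v\<bar>))
    \<le> (SUP v\<in>S. ennreal (f v + t v)) + (SUP v\<in>S. ennreal (f v - t v))"
proof (rule SUP_ennreal_add_le)
  fix v w assume S: "v \<in> S" "w \<in> S"
  show "ennreal (f v + \<bar>t v\<bar>) + ennreal (f w - \<bar>t w\<bar>)
    \<le> (SUP v\<in>S. ennreal (f v + t v)) + (SUP v\<in>S. ennreal (f v - t v))"
  proof (cases "0 \<le> t v")
    case True
    with S show ?thesis
      by (intro add_mono SUP_upper2[of v] SUP_upper2[of w] ennreal_leI) auto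
  next
    case False
    with S show ?thesis
      by (subst (2) add.commute, intro add_mono SUP_upper2[of v] SUP_upper2[of w] ennreal_leI) auto
  qed
qed

text \<open>The absolute values are removed one coordinate at a time; at coordinate \<open>j\<close>
  each sign set is paired with the one that differs from it exactly in \<open>j\<close>.\<close>

lemma sum_SUP_set_sign_abs_le:
  fixes t :: "'v \<Rightarrow> 'n::finite \<Rightarrow> real"
  shows "(\<Sum>A\<in>UNIV. SUP v\<in>S. ennreal (\<Sum>i\<in>UNIV. set_sign A i * \<bar>t v i\<bar>))
    \<le> (\<Sum>A\<in>UNIV. SUP v\<in>S. ennreal (\<Sum>i\<in>UNIV. set_sign A i * t v i))"
proof -
  \<comment> \<open>Interpolates between the two sides: the absolute value is already gone on
    \<open>J\<close> and still present elsewhere.\<close>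
  define h where "h J A = (SUP v\<in>S. ennreal (\<Sum>i\<in>UNIV. set_sign A i * (if i \<in> J then t v i else \<bar>t v i\<bar>)))"
    for J A :: "'n set"
  have step: "sum (h J) UNIV \<le> sum (h (insert j J)) UNIV" if j: "j \<notin> J" for j J
  proof -
    define flip where "flip A = (if j \<in> A then A - {j} else insert j A)" for A
    have flip_flip: "flip (flip A) = A" for A
      by (auto simp: flip_def)
    have sum_flip: "(\<Sum>A\<in>UNIV. g (flip A)) = sum g UNIV" for g :: "'n set \<Rightarrow> ennreal"
      by (rule sum.reindex_bij_witness[of _ flip flip]) (auto simp: flip_flip)
    have pair: "h J A + h J (flip A) \<le> h (insert j J) A + h (insert j J) (flip A)" for A
    proof -
      \<comment> \<open>The part common to \<open>A\<close> and \<open>flip A\<close>, and to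
        \<open>J\<close> and \<open>insert j J\<close>; only the term at \<open>j\<close>
        varies.\<close>
      define f where "f v = (\<Sum>i\<in>UNIV - {j}. set_sign A i * (if i \<in> J then t v i else \<bar>t v i\<bar>))" for v
      have split: "(\<Sum>i\<in>UNIV. set_sign B i * (if i \<in> J' then t v i else \<bar>t v i\<bar>))
          = f v + set_sign B j * (if j \<in> J' then t v j else \<bar>t v j\<bar>)"
        if "B = A \<or> B = flip A" "J' = J \<or> J' = insert j J" for B J' v
      proof -
        have "(\<Sum>i\<in>UNIV - {j}. set_sign B i * (if i \<in> J' then t v i else \<bar>t v i\<bar>)) = f v"
          unfolding f_def using that by (intro sum.cong refl) (auto simp: set_sign_def flip_def split: if_splits)
        then show ?thesis
          by (subst sum.remove[of _ j]) auto
      qed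
      then have h_split: "h J' B = (SUP v\<in>S. ennreal (f v + set_sign B j * (if j \<in> J' then t v j else \<bar>t v j\<bar>)))"
        if "B = A \<or> B = flip A" "J' = J \<or> J' = insert j J" for B J'
        unfolding h_def using that by simp
      note h_splits = h_split[of A J] h_split[of A "insert j J"] h_split[of "flip A" J] h_split[of "flip A" "insert j J"]
      have "set_sign (flip A) j = - set_sign A j" "set_sign A j = 1 \<or> set_sign A j = - 1"
        by (auto simp: set_sign_def flip_def)
      then show ?thesis
        using contraction_two_point[of f "\<lambda>v. t v j" S] j
        by (elim disjE) (simp_all add: h_splits add.commute)
    qed
    have "2 * sum (h J) UNIV = (\<Sum>A\<in>UNIV. h J A + h J (flip A))"
      by (simp add: sum.distrib sum_flip mult_2)
    also have "\<dots> \<le> (\<Sum>A\<in>UNIV. h (insert j J) A + h (insert j J) (flip A))"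
      by (intro sum_mono pair)
    also have "\<dots> = 2 * sum (h (insert j J)) UNIV"
      by (simp add: sum.distrib sum_flip mult_2)
    finally show ?thesis
      by (simp add: ennreal_mult_le_mult_iff)
  qed
  have "sum (h {}) UNIV \<le> sum (h J) UNIV" for J
    using finite[of J] by induction (auto intro: order_trans step)
  from this[of UNIV] show ?thesis
    by (simp add: h_def)
qed

subsection \<open>Symmetrization\<close>

text \<open>Rows in \<open>A\<close> stay and the others are exchanged, so that a difference of
  corresponding rows picks up exactly the sign \<open>set_sign A\<close>.\<close>

definition swap_rows :: "'n set \<Rightarrow> ('a^'n) \<times> ('a^'n) \<Rightarrow> ('a^'n) \<times> ('a^'n)" where
  "swap_rows A p = (\<chi> i. if i \<in> A then fst p $ i else snd p $ i, \<chi> i. if i \<in> A then snd p $ i else fst p $ i)"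

lemma swap_rows_swap_rows: "swap_rows A (swap_rows A p) = p"
  by (auto simp: swap_rows_def prod_eq_iff vec_eq_iff)

lemma inner_swap_rows:
  fixes p r :: "('a::euclidean_space ^ 'n) \<times> ('a ^ 'n)"
  shows "p \<bullet> swap_rows A r = swap_rows A p \<bullet> r"
  unfolding inner_prod_def inner_vec_def swap_rows_def
  by (auto simp: sum.distrib[symmetric] intro!: sum.cong)

lemma swap_rows_Basis:
  fixes b :: "('a::euclidean_space ^ 'n) \<times> ('a ^ 'n)"
  assumes "b \<in> Basis"
  shows "swap_rows A b \<in> Basis"
proof -
  have "swap_rows A (axis i u, 0) = (if i \<in> A then (axis i u, 0) else (0, axis i u))"
    "swap_rows A (0, axis i u) = (if i \<in> A then (0, axis i u) else (axis i u, 0))" for i and u :: 'a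
    by (auto simp: swap_rows_def vec_eq_iff axis_def)
  then have "swap_rows A (axis i u, 0) \<in> Basis" "swap_rows A (0, axis i u) \<in> Basis"
    if "u \<in> Basis" for i and u :: 'a
    using that by (auto simp: Basis_prod_def image_iff axis_in_Basis_iff)
  moreover have "(\<exists>i u. u \<in> Basis \<and> b = (axis i u, 0)) \<or> (\<exists>i u. u \<in> Basis \<and> b = (0, axis i u))"
    using assms by (auto simp: Basis_prod_def Basis_vec_def)
  ultimately show ?thesis by auto
qed

text \<open>\<open>swap_rows A\<close> is a self-adjoint involution that permutes the basis, so its
  coordinate functionals are given by distinct basis vectors.\<close>

lemma distr_std_gaussian_swap_rows:
  "distr std_gaussian borel (swap_rows A)
    = (std_gaussian :: (('a::euclidean_space ^ 'n) \<times> ('a ^ 'n)) measure)"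
proof -
  have "(\<Sum>b\<in>Basis. (x \<bullet> swap_rows A b) *\<^sub>R b) = swap_rows A x" for x :: "('a ^ 'n) \<times> ('a ^ 'n)"
    by (simp add: inner_swap_rows euclidean_representation)
  moreover have "swap_rows A b \<noteq> swap_rows A b'" if "b \<noteq> b'" for b b' :: "('a ^ 'n) \<times> ('a ^ 'n)"
    using that swap_rows_swap_rows by metis
  then have "distr std_gaussian borel (\<lambda>x. \<Sum>b\<in>Basis. (x \<bullet> swap_rows A b) *\<^sub>R b)
    = (std_gaussian :: (('a ^ 'n) \<times> ('a ^ 'n)) measure)"
    by (intro distr_std_gaussian_disjoint_supports)
       (simp_all add: swap_rows_Basis inner_Basis, metis)
  ultimately show ?thesis by simp
qed

text \<open>Coordinate \<open>b\<close> of the sum reads only the \<open>b\<close>-entries of the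
  rows, so supports are disjoint; n squared signs, each divided by n, give unit norm.\<close>

lemma distr_std_gaussian_sum_rows:
  assumes "\<And>i. (s i)\<^sup>2 = 1"
  shows "distr (std_gaussian :: ('a::euclidean_space ^ 'n) measure) borel
      (\<lambda>X. \<Sum>i\<in>UNIV. (s i / sqrt (real CARD('n))) *\<^sub>R (X $ i)) = std_gaussian"
proof -
  define a :: "'a \<Rightarrow> 'a ^ 'n" where "a b = (\<chi> i. (s i / sqrt (real CARD('n))) *\<^sub>R b)" for b
  have "distr std_gaussian borel (\<lambda>X. \<Sum>b\<in>Basis. (X \<bullet> a b) *\<^sub>R b) = std_gaussian"
  proof (rule distr_std_gaussian_disjoint_supports)
    fix b :: 'a assume b: "b \<in> Basis"
    have "(norm (a b))\<^sup>2 = (\<Sum>i\<in>(UNIV::'n set). (s i)\<^sup>2 / real CARD('n))"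
      unfolding power2_norm_eq_inner inner_vec_def using b
      by (simp add: a_def power2_eq_square real_sqrt_mult[symmetric] flip: of_nat_mult)
    then show "norm (a b) = 1"
      using assms norm_ge_zero[of "a b"] by (simp add: power2_eq_1_iff del: norm_ge_zero)
  next
    fix b b' :: 'a and i :: "'a ^ 'n"
    assume "b \<in> Basis" "b' \<in> Basis" "i \<in> Basis" "b \<noteq> b'"
    then show "a b \<bullet> i = 0 \<or> a b' \<bullet> i = 0"
      by (auto simp: Basis_vec_def inner_axis a_def inner_Basis)
  qed
  moreover have "(\<Sum>b\<in>Basis. (X \<bullet> a b) *\<^sub>R b) = (\<Sum>i\<in>UNIV. (s i / sqrt (real CARD('n))) *\<^sub>R (X $ i))"
    for X :: "'a ^ 'n"
  proof -
    have "(\<Sum>b\<in>Basis. (X \<bullet> a b) *\<^sub>R b)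
      = (\<Sum>b\<in>Basis. ((\<Sum>i\<in>UNIV. (s i / sqrt (real CARD('n))) *\<^sub>R (X $ i)) \<bullet> b) *\<^sub>R b)"
      by (intro sum.cong refl) (simp add: inner_vec_def a_def inner_sum_left)
    then show ?thesis by (simp add: euclidean_representation)
  qed
  ultimately show ?thesis by simp
qed

section \<open>Measurability and means of row functionals\<close>

lemma borel_measurable_SUP_linear_abs [measurable]:
  fixes S :: "(real ^ 'q) set"
  shows "(\<lambda>X :: real ^ 'q ^ 'n. SUP v\<in>S. ennreal (\<Sum>i\<in>UNIV. s i * \<bar>X $ i \<bullet> v\<bar>)) \<in> borel_measurable borel"
  by (intro borel_measurable_SUP_continuous continuous_intros)

lemma borel_measurable_SUP_inner [measurable]:
  fixes S :: "'a::euclidean_space set"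
  shows "(\<lambda>x. SUP v\<in>S. ennreal (x \<bullet> v)) \<in> borel_measurable borel"
  by (intro borel_measurable_SUP_continuous continuous_intros)

lemma borel_measurable_vec_nth' [measurable]:
  "(\<lambda>X :: 'a::euclidean_space ^ 'n. X $ i) \<in> borel_measurable borel"
  by (intro borel_measurable_continuous_onI continuous_intros)

lemma nn_integral_sum_abs_rows:
  fixes v :: "'a::euclidean_space"
  shows "(\<integral>\<^sup>+X. ennreal (\<Sum>i\<in>UNIV. \<bar>X $ i \<bullet> v\<bar>) \<partial>(std_gaussian :: ('a ^ 'n) measure))
    = ennreal (real CARD('n) * (sqrt (2 / pi) * norm v))"
proof -
  have "(\<integral>\<^sup>+X. ennreal \<bar>X $ i \<bullet> v\<bar> \<partial>(std_gaussian :: ('a ^ 'n) measure)) = ennreal (sqrt (2 / pi) * norm v)"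
    for i :: 'n
    \<comment> \<open>\<open>X $ i \<bullet> v\<close> is the inner product of \<open>X\<close> with
      the matrix that has \<open>v\<close> in row \<open>i\<close> and zeros elsewhere.\<close>
    using nn_integral_abs_inner_std_gaussian[of "axis i v"]
    by (simp add: inner_axis norm_eq_sqrt_inner inner_axis_axis)
  then show ?thesis
    by (simp add: sum_ennreal[symmetric] nn_integral_sum ennreal_mult ennreal_of_nat_eq_real_of_nat
        del: sum_ennreal)
qed

text \<open>Jensen's inequality: averaging over an independent copy inside the supremum.\<close>

lemma SUP_centered_le_nn_integral:
  fixes S :: "(real ^ 'q) set" and Y :: "real ^ 'q ^ 'n"
  shows "(SUP v\<in>S. ennreal (\<Sum>i\<in>UNIV. sqrt (2 / pi) * norm v - \<bar>Y $ i \<bullet> v\<bar>))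
    \<le> (\<integral>\<^sup>+X. (SUP v\<in>S. ennreal (\<Sum>i\<in>UNIV. \<bar>X $ i \<bullet> v\<bar> - \<bar>Y $ i \<bullet> v\<bar>)) \<partial>(std_gaussian :: (real ^ 'q ^ 'n) measure))"
proof (rule SUP_least)
  fix v assume v: "v \<in> S"
  let ?G = "std_gaussian :: (real ^ 'q ^ 'n) measure"
  let ?y = "\<Sum>i\<in>UNIV. \<bar>Y $ i \<bullet> v\<bar>"
  let ?d = "\<lambda>X. ennreal (\<Sum>i\<in>UNIV. \<bar>X $ i \<bullet> v\<bar> - \<bar>Y $ i \<bullet> v\<bar>)"
  have "ennreal (real CARD('n) * (sqrt (2 / pi) * norm v)) = (\<integral>\<^sup>+X. ennreal (\<Sum>i\<in>UNIV. \<bar>X $ i \<bullet> v\<bar>) \<partial>?G)"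
    by (rule nn_integral_sum_abs_rows[symmetric])
  \<comment> \<open>Since \<open>?d\<close> is clipped at 0, \<open>?y\<close> is added before
    integrating and subtracted afterwards; truncated subtraction agrees with clipping.\<close>
  also have "\<dots> \<le> (\<integral>\<^sup>+X. ennreal ?y + ?d X \<partial>?G)"
  proof (rule nn_integral_mono)
    fix X :: "real ^ 'q ^ 'n"
    have "(\<Sum>i\<in>UNIV. \<bar>X $ i \<bullet> v\<bar>) = ?y + (\<Sum>i\<in>UNIV. \<bar>X $ i \<bullet> v\<bar> - \<bar>Y $ i \<bullet> v\<bar>)"
      by (simp add: sum_subtractf)
    then show "ennreal (\<Sum>i\<in>UNIV. \<bar>X $ i \<bullet> v\<bar>) \<le> ennreal ?y + ?d X"
      using ennreal_add_le by simp
  qed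
  also have "\<dots> = ennreal ?y + (\<integral>\<^sup>+X. ?d X \<partial>?G)"
    using std_gaussian.emeasure_space_1[where 'a = "real ^ 'q ^ 'n"] by (subst nn_integral_add) auto
  finally have "ennreal (real CARD('n) * (sqrt (2 / pi) * norm v)) - ennreal ?y \<le> (\<integral>\<^sup>+X. ?d X \<partial>?G)"
    by (simp add: ennreal_minus_le_iff)
  then have "ennreal (\<Sum>i\<in>(UNIV::'n set). sqrt (2 / pi) * norm v - \<bar>Y $ i \<bullet> v\<bar>) \<le> (\<integral>\<^sup>+X. ?d X \<partial>?G)"
    by (simp add: ennreal_minus sum_nonneg sum_subtractf)
  also have "\<dots> \<le> (\<integral>\<^sup>+X. (SUP v\<in>S. ennreal (\<Sum>i\<in>UNIV. \<bar>X $ i \<bullet> v\<bar> - \<bar>Y $ i \<bullet> v\<bar>)) \<partial>?G)"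
    using v by (intro nn_integral_mono SUP_upper)
  finally show "ennreal (\<Sum>i\<in>(UNIV::'n set). sqrt (2 / pi) * norm v - \<bar>Y $ i \<bullet> v\<bar>)
    \<le> (\<integral>\<^sup>+X. (SUP v\<in>S. ennreal (\<Sum>i\<in>UNIV. \<bar>X $ i \<bullet> v\<bar> - \<bar>Y $ i \<bullet> v\<bar>)) \<partial>?G)" .
qed

text \<open>For each fixed sign pattern the signed row sum divided by the square root of n is
  standard Gaussian, so the value is the same for all \<open>A\<close>.\<close>

lemma nn_integral_SUP_set_sign:
  fixes S :: "(real ^ 'q) set"
  shows "(\<integral>\<^sup>+X. (SUP v\<in>S. ennreal (\<Sum>i\<in>UNIV. set_sign A i * (X $ i \<bullet> v))) \<partial>(std_gaussian :: (real ^ 'q ^ 'n) measure))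
    = ennreal (sqrt (real CARD('n))) * (\<integral>\<^sup>+g. (SUP v\<in>S. ennreal (g \<bullet> v)) \<partial>std_gaussian)"
proof -
  let ?n = "sqrt (real CARD('n))"
  let ?T = "\<lambda>X :: real ^ 'q ^ 'n. \<Sum>i\<in>UNIV. (set_sign A i / ?n) *\<^sub>R (X $ i)"
  have law: "distr std_gaussian borel ?T = std_gaussian"
    by (rule distr_std_gaussian_sum_rows) (simp add: set_sign_def)
  have "(SUP v\<in>S. ennreal (\<Sum>i\<in>UNIV. set_sign A i * (X $ i \<bullet> v))) = ennreal ?n * (SUP v\<in>S. ennreal (?T X \<bullet> v))"
    for X :: "real ^ 'q ^ 'n"
  proof -
    have "(\<Sum>i\<in>UNIV. set_sign A i * (X $ i \<bullet> v)) = ?n * (?T X \<bullet> v)" for v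
      by (simp add: inner_sum_left sum_distrib_left)
    then show ?thesis
      by (simp add: ennreal_mult' SUP_mult_left_ennreal)
  qed
  moreover have [measurable]: "?T \<in> borel_measurable borel"
    by (intro borel_measurable_continuous_onI continuous_intros)
  then have "(\<integral>\<^sup>+g. (SUP v\<in>S. ennreal (g \<bullet> v)) \<partial>std_gaussian) = (\<integral>\<^sup>+X. (SUP v\<in>S. ennreal (?T X \<bullet> v)) \<partial>std_gaussian)"
    by (subst law[symmetric], subst nn_integral_distr) auto
  moreover have "(\<lambda>X. SUP v\<in>S. ennreal (?T X \<bullet> v)) \<in> borel_measurable std_gaussian"
    by measurable
  ultimately show ?thesis
    by (simp add: nn_integral_cmult)
qed

lemma gaussian_l1_deviation:
  fixes S :: "(real ^ 'q) set"
  shows "(\<integral>\<^sup>+Y. (SUP v\<in>S. ennreal (\<Sum>i\<in>UNIV. sqrt (2 / pi) * norm v - \<bar>Y $ i \<bullet> v\<bar>))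
            \<partial>(std_gaussian :: (real ^ 'q ^ 'n) measure))
    \<le> 2 * ennreal (sqrt (real CARD('n))) * (\<integral>\<^sup>+g. (SUP v\<in>S. ennreal (g \<bullet> v)) \<partial>std_gaussian)"
    (is "?L \<le> _")
proof -
  let ?G = "std_gaussian :: (real ^ 'q ^ 'n) measure"
  interpret pair_prob_space ?G ?G ..
  define D where "D A p = (SUP v\<in>S. ennreal (\<Sum>i\<in>UNIV. set_sign A i * (\<bar>fst p $ i \<bullet> v\<bar> - \<bar>snd p $ i \<bullet> v\<bar>)))"
    for A :: "'n set" and p :: "(real ^ 'q ^ 'n) \<times> (real ^ 'q ^ 'n)"
  define H where "H A X = (SUP v\<in>S. ennreal (\<Sum>i\<in>UNIV. set_sign A i * \<bar>X $ i \<bullet> v\<bar>))"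
    for A :: "'n set" and X :: "real ^ 'q ^ 'n"
  define W where "W = (\<integral>\<^sup>+g. (SUP v\<in>S. ennreal (g \<bullet> v)) \<partial>(std_gaussian :: (real ^ 'q) measure))"
  have D_borel: "D A \<in> borel_measurable borel" for A
    unfolding D_def by (intro borel_measurable_SUP_continuous continuous_intros)
  then have D_meas [measurable]: "D A \<in> borel_measurable (?G \<Otimes>\<^sub>M ?G)" for A
    unfolding std_gaussian_prod measurable_cong_sets[OF sets_std_gaussian refl] .
  have H_meas [measurable]: "H A \<in> borel_measurable ?G" for A
    unfolding H_def by measurable
  have swap_meas: "swap_rows A \<in> borel_measurable (borel :: ((real ^ 'q ^ 'n) \<times> (real ^ 'q ^ 'n)) measure)" for A
  proof -
    have "continuous_on UNIV (\<lambda>p :: (real ^ 'q ^ 'n) \<times> (real ^ 'q ^ 'n). if i \<in> B then fst p $ i else snd p $ i)"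
      "continuous_on UNIV (\<lambda>p :: (real ^ 'q ^ 'n) \<times> (real ^ 'q ^ 'n). if i \<in> B then snd p $ i else fst p $ i)"
      for B i by (cases "i \<in> B"; simp add: continuous_intros)+
    then show ?thesis
      unfolding swap_rows_def by (intro borel_measurable_continuous_onI continuous_intros)
  qed
  have "?L \<le> (\<integral>\<^sup>+Y. \<integral>\<^sup>+X. D UNIV (X, Y) \<partial>?G \<partial>?G)"
    unfolding D_def set_sign_def using SUP_centered_le_nn_integral[where S = S]
    by (intro nn_integral_mono) simp
  also have "\<dots> = integral\<^sup>N (?G \<Otimes>\<^sub>M ?G) (D UNIV)"
    by (rule nn_integral_snd) simp
  finally have L: "?L \<le> integral\<^sup>N (?G \<Otimes>\<^sub>M ?G) (D UNIV)" .
  \<comment> \<open>Swapping rows preserves the law of the pair, so the signs of any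
    \<open>A\<close> may be inserted. The second matrix carries the opposite signs, which is the
    complement \<open>- A\<close>.\<close>
  have sym: "integral\<^sup>N (?G \<Otimes>\<^sub>M ?G) (D UNIV) \<le> (\<integral>\<^sup>+X. H A X \<partial>?G) + (\<integral>\<^sup>+X. H (- A) X \<partial>?G)" for A
  proof -
    have swap: "D UNIV (swap_rows A p) = D A p" for p
      unfolding D_def
      by (intro SUP_cong refl arg_cong[where f = ennreal] sum.cong) (simp_all add: set_sign_def swap_rows_def)
    have "integral\<^sup>N (?G \<Otimes>\<^sub>M ?G) (D UNIV) = integral\<^sup>N (distr std_gaussian borel (swap_rows A)) (D UNIV)"
      by (simp add: distr_std_gaussian_swap_rows std_gaussian_prod)
    also have "\<dots> = (\<integral>\<^sup>+p. D UNIV (swap_rows A p) \<partial>std_gaussian)"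
      using swap_meas D_borel by (intro nn_integral_distr) (auto cong: measurable_cong_sets)
    also have "\<dots> = (\<integral>\<^sup>+Y. \<integral>\<^sup>+X. D A (X, Y) \<partial>?G \<partial>?G)"
      unfolding swap std_gaussian_prod[symmetric] by (rule nn_integral_snd[symmetric]) simp
    also have "\<dots> \<le> (\<integral>\<^sup>+Y. \<integral>\<^sup>+X. H A X + H (- A) Y \<partial>?G \<partial>?G)"
    proof (intro nn_integral_mono)
      fix X Y
      show "D A (X, Y) \<le> H A X + H (- A) Y"
        unfolding D_def
      proof (rule SUP_least)
        fix v assume v: "v \<in> S"
        have "(\<Sum>i\<in>UNIV. set_sign A i * (\<bar>X $ i \<bullet> v\<bar> - \<bar>Y $ i \<bullet> v\<bar>))
          = (\<Sum>i\<in>UNIV. set_sign A i * \<bar>X $ i \<bullet> v\<bar>) + (\<Sum>i\<in>UNIV. set_sign (- A) i * \<bar>Y $ i \<bullet> v\<bar>)"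
          unfolding sum.distrib[symmetric] by (intro sum.cong refl) (simp add: set_sign_def)
        then show "ennreal (\<Sum>i\<in>UNIV. set_sign A i * (\<bar>fst (X, Y) $ i \<bullet> v\<bar> - \<bar>snd (X, Y) $ i \<bullet> v\<bar>)) \<le> H A X + H (- A) Y"
          unfolding H_def using v
          by (auto intro!: order_trans[OF ennreal_add_le] add_mono SUP_upper)
      qed
    qed
    also have "\<dots> = (\<integral>\<^sup>+X. H A X \<partial>?G) + (\<integral>\<^sup>+X. H (- A) X \<partial>?G)"
      using std_gaussian.emeasure_space_1[where 'a = "real ^ 'q ^ 'n"] by (simp add: nn_integral_add)
    finally show ?thesis .
  qed
  have "(\<Sum>A\<in>UNIV. \<integral>\<^sup>+X. H A X \<partial>?G) = (\<integral>\<^sup>+X. (\<Sum>A\<in>UNIV. H A X) \<partial>?G)"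
    by (simp add: nn_integral_sum)
  also have "\<dots> \<le> (\<integral>\<^sup>+X. (\<Sum>A\<in>UNIV. SUP v\<in>S. ennreal (\<Sum>i\<in>UNIV. set_sign A i * (X $ i \<bullet> v))) \<partial>?G)"
    unfolding H_def by (intro nn_integral_mono sum_SUP_set_sign_abs_le)
  also have "\<dots> = (\<Sum>A\<in>UNIV. \<integral>\<^sup>+X. (SUP v\<in>S. ennreal (\<Sum>i\<in>UNIV. set_sign A i * (X $ i \<bullet> v))) \<partial>?G)"
    by (rule nn_integral_sum)
       (auto intro!: borel_measurable_SUP_continuous continuous_intros cong: measurable_cong_sets)
  also have "\<dots> = (\<Sum>A\<in>(UNIV :: 'n set set). ennreal (sqrt (real CARD('n))) * W)"
    unfolding W_def nn_integral_SUP_set_sign ..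
  finally have total: "(\<Sum>A\<in>UNIV. \<integral>\<^sup>+X. H A X \<partial>?G)
    \<le> (\<Sum>A\<in>(UNIV :: 'n set set). ennreal (sqrt (real CARD('n))) * W)" .
  \<comment> \<open>Averaging over all sign sets: complementation permutes them, so the two terms of
    \<open>sym\<close> contribute equally, and this is the factor 2.\<close>
  have "(2 ^ CARD('n)) * integral\<^sup>N (?G \<Otimes>\<^sub>M ?G) (D UNIV) = (\<Sum>A\<in>(UNIV :: 'n set set). integral\<^sup>N (?G \<Otimes>\<^sub>M ?G) (D UNIV))"
    by (simp add: card_UNIV_set)
  also have "\<dots> \<le> (\<Sum>A\<in>UNIV. (\<integral>\<^sup>+X. H A X \<partial>?G) + (\<integral>\<^sup>+X. H (- A) X \<partial>?G))"
    by (intro sum_mono sym)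
  also have "\<dots> = 2 * (\<Sum>A\<in>UNIV. \<integral>\<^sup>+X. H A X \<partial>?G)"
  proof -
    have "(\<Sum>A\<in>UNIV. \<integral>\<^sup>+X. H (- A) X \<partial>?G) = (\<Sum>A\<in>UNIV. \<integral>\<^sup>+X. H A X \<partial>?G)"
      by (rule sum.reindex_bij_witness[of _ uminus uminus]) auto
    then show ?thesis by (simp add: sum.distrib mult_2)
  qed
  also have "\<dots> \<le> 2 * (\<Sum>A\<in>(UNIV :: 'n set set). ennreal (sqrt (real CARD('n))) * W)"
    using total by (rule mult_left_mono) simp
  also have "\<dots> = 2 ^ CARD('n) * (2 * ennreal (sqrt (real CARD('n))) * W)"
    by (simp add: card_UNIV_set ac_simps)
  finally have "integral\<^sup>N (?G \<Otimes>\<^sub>M ?G) (D UNIV) \<le> 2 * ennreal (sqrt (real CARD('n))) * W"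
    by (subst (asm) ennreal_mult_le_mult_iff) (auto simp: power_eq_top_ennreal)
  with L show ?thesis
    unfolding W_def by (rule order_trans)
qed

subsection \<open>The Minkowski functional and the recovery error\<close>

context
  fixes K :: "'a::euclidean_space set"
  assumes convex: "convex K" and zero_interior: "0 \<in> interior K"
begin

lemma minkowski_functional_le_one:
  assumes "x \<in> K"
  shows "minkowski_functional K x \<le> 1"
  unfolding minkowski_functional_def
  using assms by (intro cInf_lower) (auto intro!: bdd_belowI[of _ 0])

text \<open>Some admissible \<open>t\<close> lies below \<open>s\<close>, and
  \<open>inverse s *\<^sub>R x\<close> is on the segment from 0 to
  \<open>inverse t *\<^sub>R x\<close>.\<close>

lemma scaleR_mem_of_minkowski_functional_less:
  assumes "minkowski_functional K x < s"
  shows "inverse s *\<^sub>R x \<in> K"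
proof -
  let ?T = "{t. 0 < t \<and> inverse t *\<^sub>R x \<in> K}"
  obtain r where r: "0 < r" "ball 0 r \<subseteq> K"
    using zero_interior by (auto simp: mem_interior)
  \<comment> \<open>Shows that the infimum is over a nonempty set; the summand 1 keeps
    \<open>t\<close> positive for \<open>x = 0\<close> and the ball inequality strict.\<close>
  define t where "t = norm x / r + 1"
  have "0 < t" "norm x < r * t"
    using r(1) by (simp_all add: t_def distrib_left add_nonneg_pos)
  then have "inverse t *\<^sub>R x \<in> ball 0 r"
    by (simp add: field_simps)
  with r \<open>0 < t\<close> have "?T \<noteq> {}"
    by blast
  then obtain t where t: "0 < t" "inverse t *\<^sub>R x \<in> K" "t < s"
    using assms cInf_lessD[of ?T s] unfolding minkowski_functional_def by auto
  have "(t / s) *\<^sub>R (inverse t *\<^sub>R x) + (1 - t / s) *\<^sub>R 0 \<in> K"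
    using t zero_interior interior_subset[of K] by (intro convexD[OF convex]) auto
  then show ?thesis
    using t by (simp add: field_simps)
qed

text \<open>Every scale above 1 brings \<open>x\<close> into \<open>K\<close>; closedness allows the
  scale to tend to 1.\<close>

lemma mem_of_minkowski_functional_le_one:
  assumes "closed K" and "minkowski_functional K x \<le> 1"
  shows "x \<in> K"
proof (rule closed_sequentially[OF \<open>closed K\<close>])
  show "inverse (1 + inverse (real (Suc k))) *\<^sub>R x \<in> K" for k
  proof (rule scaleR_mem_of_minkowski_functional_less)
    have "0 < inverse (real (Suc k))" by simp
    then show "minkowski_functional K x < 1 + inverse (real (Suc k))"
      using assms(2) by linarith
  qed
  have "(\<lambda>k. inverse (1 + inverse (real (Suc k))) *\<^sub>R x) \<longlonglongrightarrow> inverse (1 + 0) *\<^sub>R x"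
    by (intro tendsto_intros LIMSEQ_inverse_real_of_nat) simp
  then show "(\<lambda>k. inverse (1 + inverse (real (Suc k))) *\<^sub>R x) \<longlonglongrightarrow> x"
    by simp
qed

end

text \<open>The interior inherits symmetry and convexity, so it contains the midpoint of
  \<open>x\<close> and \<open>- x\<close>.\<close>

lemma zero_in_interior_symmetric_convex:
  fixes K :: "'a::euclidean_space set"
  assumes "convex K" and "\<And>x. x \<in> K \<Longrightarrow> - x \<in> K" and "interior K \<noteq> {}"
  shows "0 \<in> interior K"
proof -
  obtain x where x: "x \<in> interior K"
    using assms(3) by auto
  have "uminus ` K = K"
    using assms(2) by (auto simp: image_iff) (metis minus_minus)
  then have "- x \<in> interior K"
    using x interior_negations[of K] by auto
  then have "(1/2) *\<^sub>R x + (1/2) *\<^sub>R (- x) \<in> interior K"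
    using x by (intro convexD[OF convex_interior[OF assms(1)]]) auto
  then show ?thesis by simp
qed

section \<open>The l1 norm and feasible points of the recovery program\<close>

lemma norm1_minus: "norm1 (- v) = norm1 v"
  by (simp add: norm1_def)

lemma norm1_add_le: "norm1 (v + w) \<le> norm1 v + norm1 w"
  by (simp add: norm1_def sum.distrib[symmetric] sum_mono abs_triangle_ineq)

lemma norm1_matrix_vector_mult: "norm1 (B *v v) = (\<Sum>i\<in>UNIV. \<bar>B $ i \<bullet> v\<bar>)"
  by (simp add: norm1_def matrix_vector_mul_component)

lemma l1_recovery_solutions_error:
  fixes K :: "(real ^ 'p) set" and A :: "real ^ 'p ^ 'n"
  assumes K: "compact K" "convex K" "0 \<in> interior K"
    and xs: "xs \<in> K" and nu: "norm1 nu / real CARD('n) \<le> eps"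
    and xh: "xh \<in> l1_recovery_solutions K eps A (A *v xs + nu)"
  shows "xh \<in> K" and "norm1 (A *v (xh - xs)) \<le> 2 * eps * real CARD('n)"
proof -
  have n: "0 < real CARD('n)" by simp
  have fit: "norm1 (A *v xh - (A *v xs + nu)) / real CARD('n) \<le> eps"
    and opt: "\<And>z. norm1 (A *v z - (A *v xs + nu)) / real CARD('n) \<le> eps \<Longrightarrow>
      minkowski_functional K xh \<le> minkowski_functional K z"
    using xh by (auto simp: l1_recovery_solutions_def)
  \<comment> \<open>The true signal is feasible, its residual being \<open>- nu\<close>.\<close>
  have "minkowski_functional K xh \<le> minkowski_functional K xs"
    using nu by (intro opt) (simp add: norm1_minus)
  also have "\<dots> \<le> 1"
    using K xs by (intro minkowski_functional_le_one) auto
  finally show "xh \<in> K"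
    by (rule mem_of_minkowski_functional_le_one[OF K(2,3) compact_imp_closed[OF K(1)]])
  have "A *v (xh - xs) = (A *v xh - (A *v xs + nu)) + nu"
    by (simp add: matrix_vector_mult_diff_distrib)
  then have "norm1 (A *v (xh - xs)) \<le> norm1 (A *v xh - (A *v xs + nu)) + norm1 nu"
    using norm1_add_le by metis
  then show "norm1 (A *v (xh - xs)) \<le> 2 * eps * real CARD('n)"
    using fit nu n by (simp add: field_simps)
qed

section \<open>From the one-sided deviation to the recovery bound\<close>

theorem theorem7:
  fixes C :: "real ^ 'p ^ 'q" and K :: "(real ^ 'p) set" and eps :: real
  assumes "compact K" and "convex K" and "\<And>x. x \<in> K \<Longrightarrow> - x \<in> K"
    and "interior K \<noteq> {}" and "eps \<ge> 0"
  shows "outer_nn_integral (std_gaussian :: (real ^ 'q ^ 'n) measure)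
           (\<lambda>B. SUP (xs, nu, xh) \<in> {(xs, nu, xh). xs \<in> K \<and> norm1 nu / real CARD('n) \<le> eps \<and>
                     xh \<in> l1_recovery_solutions K eps (B ** C) ((B ** C) *v xs + nu)}.
                  ennreal (sqrt ((xh - xs) \<bullet> ((transpose C ** C) *v (xh - xs)))))
         \<le> ennreal (sqrt (2 * pi)) *
             ((\<integral>\<^sup>+ g. (SUP u \<in> {a - b | a b. a \<in> K \<and> b \<in> K}.
                         ennreal \<bar>(transpose C *v g) \<bullet> u\<bar>)
                 \<partial>(std_gaussian :: (real ^ 'q) measure)) / ennreal (sqrt (real CARD('n)))
              + ennreal eps)"
proof -
  let ?n = "real CARD('n)"
  define S where "S = (\<lambda>u. C *v u) ` {a - b | a b. a \<in> K \<and> b \<in> K}"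
  define Z where "Z B = (SUP v\<in>S. ennreal (\<Sum>i\<in>UNIV. sqrt (2 / pi) * norm v - \<bar>B $ i \<bullet> v\<bar>))"
    for B :: "real ^ 'q ^ 'n"
  \<comment> \<open>A measurable majorant that bounds the outer expectation. The factor
    \<open>sqrt (pi / 2)\<close> inverts the mean constant \<open>sqrt (2 / pi)\<close>.\<close>
  define h where "h B = ennreal (sqrt (pi / 2)) * (Z B / ennreal ?n + ennreal (2 * eps))" for B
  define W where "W = (\<integral>\<^sup>+ g. (SUP u \<in> {a - b | a b. a \<in> K \<and> b \<in> K}.
      ennreal \<bar>(transpose C *v g) \<bullet> u\<bar>) \<partial>(std_gaussian :: (real ^ 'q) measure))"
  have zero: "0 \<in> interior K"
    using assms(2-4) by (rule zero_in_interior_symmetric_convex)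
  have Z_meas [measurable]: "Z \<in> borel_measurable borel"
    unfolding Z_def by (intro borel_measurable_SUP_continuous continuous_intros)
  have pointwise: "ennreal (sqrt ((xh - xs) \<bullet> ((transpose C ** C) *v (xh - xs)))) \<le> h B"
    if xs: "xs \<in> K" and nu: "norm1 nu / ?n \<le> eps"
      and xh: "xh \<in> l1_recovery_solutions K eps (B ** C) ((B ** C) *v xs + nu)"
    for xs nu xh and B :: "real ^ 'q ^ 'n"
  proof -
    define v where "v = C *v (xh - xs)"
    note error = l1_recovery_solutions_error[OF assms(1,2) zero xs nu xh]
    have "v \<in> S"
      unfolding v_def S_def using xs error(1) by blast
    have "(xh - xs) \<bullet> ((transpose C ** C) *v (xh - xs)) = v \<bullet> v"
      unfolding v_def matrix_vector_mul_assoc[symmetric] transpose_matrix_vector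
      by (metis dot_lmul_matrix inner_commute)
    moreover have "sqrt (pi / 2) * sqrt (2 / pi) = 1"
      by (simp flip: real_sqrt_mult)
    ultimately have "sqrt ((xh - xs) \<bullet> ((transpose C ** C) *v (xh - xs))) = sqrt (pi / 2) * (sqrt (2 / pi) * norm v)"
      by (simp only: norm_eq_sqrt_inner mult.assoc[symmetric] mult_1)
    moreover have "sqrt (2 / pi) * norm v
      \<le> (\<Sum>i\<in>UNIV. sqrt (2 / pi) * norm v - \<bar>B $ i \<bullet> v\<bar>) / ?n + 2 * eps"
    proof -
      have "B *v v = (B ** C) *v (xh - xs)"
        by (simp add: v_def matrix_vector_mul_assoc)
      then have "(\<Sum>i\<in>UNIV. \<bar>B $ i \<bullet> v\<bar>) \<le> 2 * eps * ?n"
        using error(2) norm1_matrix_vector_mult[of B v] by simp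
      moreover have "(\<Sum>i\<in>UNIV. l - \<bar>B $ i \<bullet> v\<bar>) / ?n = l - (\<Sum>i\<in>UNIV. \<bar>B $ i \<bullet> v\<bar>) / ?n" for l
        by (simp add: sum_subtractf diff_divide_distrib)
      ultimately show ?thesis
        by (simp add: pos_divide_le_eq)
    qed
    ultimately have "ennreal (sqrt ((xh - xs) \<bullet> ((transpose C ** C) *v (xh - xs))))
      \<le> ennreal (sqrt (pi / 2) * ((\<Sum>i\<in>UNIV. sqrt (2 / pi) * norm v - \<bar>B $ i \<bullet> v\<bar>) / ?n + 2 * eps))"
      by (intro ennreal_leI) (simp only: mult_left_mono real_sqrt_ge_zero pi_ge_zero divide_nonneg_pos zero_less_numeral)
    also have "\<dots> \<le> ennreal (sqrt (pi / 2)) *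
        (ennreal ((\<Sum>i\<in>UNIV. sqrt (2 / pi) * norm v - \<bar>B $ i \<bullet> v\<bar>) / ?n) + ennreal (2 * eps))"
      by (subst ennreal_mult', simp, intro mult_left_mono ennreal_add_le zero_le)
    also have "\<dots> \<le> h B"
    proof -
      have "ennreal ((\<Sum>i\<in>UNIV. sqrt (2 / pi) * norm v - \<bar>B $ i \<bullet> v\<bar>) / ?n)
        = ennreal (\<Sum>i\<in>UNIV. sqrt (2 / pi) * norm v - \<bar>B $ i \<bullet> v\<bar>) / ennreal ?n"
        \<comment> \<open>If the sum is negative, both sides are clipped to 0.\<close>
        by (cases "0 \<le> (\<Sum>i\<in>UNIV. sqrt (2 / pi) * norm v - \<bar>B $ i \<bullet> v\<bar>)")
           (simp_all add: divide_ennreal ennreal_neg divide_nonpos_pos)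
      moreover have "ennreal (\<Sum>i\<in>UNIV. sqrt (2 / pi) * norm v - \<bar>B $ i \<bullet> v\<bar>) \<le> Z B"
        unfolding Z_def using \<open>v \<in> S\<close> by (rule SUP_upper)
      ultimately show ?thesis
        unfolding h_def by (auto intro!: mult_left_mono add_mono divide_right_mono_ennreal)
    qed
    finally show ?thesis .
  qed
  have "outer_nn_integral (std_gaussian :: (real ^ 'q ^ 'n) measure)
           (\<lambda>B. SUP (xs, nu, xh) \<in> {(xs, nu, xh). xs \<in> K \<and> norm1 nu / real CARD('n) \<le> eps \<and>
                     xh \<in> l1_recovery_solutions K eps (B ** C) ((B ** C) *v xs + nu)}.
                  ennreal (sqrt ((xh - xs) \<bullet> ((transpose C ** C) *v (xh - xs)))))
      \<le> (\<integral>\<^sup>+B. h B \<partial>std_gaussian)"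
    unfolding outer_nn_integral_def
  proof (rule INF_lower, intro CollectI conjI ballI)
    show "h \<in> borel_measurable std_gaussian"
      unfolding h_def by measurable
  qed (auto intro!: SUP_least pointwise)
  also have "\<dots> = ennreal (sqrt (pi / 2)) * ((\<integral>\<^sup>+B. Z B \<partial>std_gaussian) / ennreal ?n + ennreal (2 * eps))"
  proof -
    have [measurable]: "Z \<in> borel_measurable std_gaussian"
      by measurable
    have "(\<integral>\<^sup>+B. ennreal (2 * eps) \<partial>(std_gaussian :: (real ^ 'q ^ 'n) measure)) = ennreal (2 * eps)"
      by (simp only: nn_integral_const std_gaussian.emeasure_space_1 mult_1_right)
    moreover have "(\<integral>\<^sup>+B. h B \<partial>std_gaussian) = ennreal (sqrt (pi / 2)) * (\<integral>\<^sup>+B. Z B / ennreal ?n + ennreal (2 * eps) \<partial>std_gaussian)"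
      unfolding h_def by (rule nn_integral_cmult) measurable
    moreover have "(\<integral>\<^sup>+B. Z B / ennreal ?n + ennreal (2 * eps) \<partial>std_gaussian)
      = (\<integral>\<^sup>+B. Z B / ennreal ?n \<partial>std_gaussian) + (\<integral>\<^sup>+B. ennreal (2 * eps) \<partial>(std_gaussian :: (real ^ 'q ^ 'n) measure))"
      by (rule nn_integral_add) measurable
    moreover have "(\<integral>\<^sup>+B. Z B / ennreal ?n \<partial>std_gaussian) = (\<integral>\<^sup>+B. Z B \<partial>std_gaussian) / ennreal ?n"
      by (rule nn_integral_divide) measurable
    ultimately show ?thesis by (simp only:)
  qed
  also have "\<dots> \<le> ennreal (sqrt (pi / 2)) * ((2 * ennreal (sqrt ?n) * W) / ennreal ?n + ennreal (2 * eps))"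
  proof -
    \<comment> \<open>The transpose moves \<open>C\<close> from \<open>u\<close> to
      \<open>g\<close>.\<close>
    have "(SUP v\<in>S. ennreal (g \<bullet> v)) \<le> (SUP u \<in> {a - b | a b. a \<in> K \<and> b \<in> K}. ennreal \<bar>(transpose C *v g) \<bullet> u\<bar>)"
      for g
    proof (rule SUP_least)
      fix v assume "v \<in> S"
      then obtain u where u: "u \<in> {a - b | a b. a \<in> K \<and> b \<in> K}" "v = C *v u"
        unfolding S_def by blast
      show "ennreal (g \<bullet> v) \<le> (SUP u \<in> {a - b | a b. a \<in> K \<and> b \<in> K}. ennreal \<bar>(transpose C *v g) \<bullet> u\<bar>)"
        using u(1) by (rule SUP_upper2) (simp add: u(2) dot_lmul_matrix ennreal_leI)
    qed
    then have "(\<integral>\<^sup>+ g. (SUP v\<in>S. ennreal (g \<bullet> v)) \<partial>std_gaussian) \<le> W"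
      unfolding W_def by (intro nn_integral_mono)
    then have "(\<integral>\<^sup>+B. Z B \<partial>std_gaussian) \<le> 2 * ennreal (sqrt ?n) * W"
      unfolding Z_def by (intro order_trans[OF gaussian_l1_deviation] mult_left_mono) auto
    then show ?thesis
      by (intro mult_left_mono add_mono divide_right_mono_ennreal) auto
  qed
  also have "\<dots> = ennreal (sqrt (2 * pi)) * (W / ennreal (sqrt ?n) + ennreal eps)"
  proof -
    have "ennreal ?n = ennreal (sqrt ?n) * ennreal (sqrt ?n)"
      by (simp flip: ennreal_mult)
    then have "2 * ennreal (sqrt ?n) * W / ennreal ?n = 2 * W * ennreal (sqrt ?n) / (ennreal (sqrt ?n) * ennreal (sqrt ?n))"
      by (simp only: ac_simps)
    also have "\<dots> = 2 * (W / ennreal (sqrt ?n))"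
      by (subst divide_mult_eq) (simp_all add: ennreal_times_divide)
    finally have "2 * ennreal (sqrt ?n) * W / ennreal ?n + ennreal (2 * eps) = 2 * (W / ennreal (sqrt ?n) + ennreal eps)"
      by (simp add: ennreal_mult' distrib_left)
    \<comment> \<open>The common factor 2 comes from symmetrization in the width term and from the
      triangle inequality in the noise term.\<close>
    moreover have "ennreal (sqrt (pi / 2)) * 2 = ennreal (sqrt (2 * pi))"
    proof -
      have "sqrt (pi / 2) * 2 = sqrt (pi / 2) * sqrt (2\<^sup>2)"
        by (subst real_sqrt_abs) simp
      also have "\<dots> = sqrt (2 * pi)"
        unfolding real_sqrt_mult[symmetric] by (simp add: power2_eq_square)
      finally have "ennreal (sqrt (pi / 2)) * ennreal 2 = ennreal (sqrt (2 * pi))"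
        by (subst ennreal_mult'[symmetric]) simp_all
      then show ?thesis by simp
    qed
    ultimately show ?thesis
      by (simp only: mult.assoc[symmetric])
  qed
  finally show ?thesis
    unfolding W_def .
qed

end
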